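(* Let $C$ be any convex subset of $\mathbb{R}^2$ and let $\mathscr{C}=\{\lambda C+r : \lambda>0,\ r\in\mathbb{R}^2\}$, where $\lambda C+r=\{\lambda c+r: c\in C\}$. Then no set $S$ of four points in $\mathbb{R}^2$ is shattered by $\mathscr{C}$; consequently $\mathscr{C}$ (in particular the collection of balls of any norm on $\mathbb{R}^2$) has VC dimension at most $3$.
   Context: A finite set $S$ is shattered by a collection $\mathscr{C}$ if for every $A\subset S$ there is $K\in\mathscr{C}$ with $S\cap K=A$. The VC dimension of $\mathscr{C}$ is the supremum of cardinalities of finite sets shattered by $\mathscr{C}$. *)

theory Defs
  imports "HOL-Analysis.Analysis" "HOL-Library.Extended_Nat"
begin

definition shatters :: "'a set set \<Rightarrow> 'a set \<Rightarrow> bool" where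
  "shatters \<C> S \<longleftrightarrow> finite S \<and> (\<forall>A\<subseteq>S. \<exists>K\<in>\<C>. S \<inter> K = A)"

(* The supremum is taken in enat, so that an unbounded family of cardinalities
   gives infinity. If \<C> is empty, no set is shattered and the value is 0. *)
definition vc_dim :: "'a set set \<Rightarrow> enat" where
  "vc_dim \<C> = (SUP S\<in>{S. shatters \<C> S}. enat (card S))"

definition pos_homothets :: "'a::real_vector set \<Rightarrow> 'a set set" where
  "pos_homothets C = {(\<lambda>c. s *\<^sub>R c + r) ` C | s r. s > 0}"

(* The type class constant norm is only one particular norm on a given type;
   this predicate makes it possible to quantify over all norms. *)
definition is_norm :: "('a::real_vector \<Rightarrow> real) \<Rightarrow> bool" where
  "is_norm N \<longleftrightarrow>
     (\<forall>x. N x \<ge> 0) \<and>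
     (\<forall>x. N x = 0 \<longleftrightarrow> x = 0) \<and>
     (\<forall>a x. N (a *\<^sub>R x) = \<bar>a\<bar> * N x) \<and>
     (\<forall>x y. N (x + y) \<le> N x + N y)"

definition open_balls :: "('a::real_vector \<Rightarrow> real) \<Rightarrow> 'a set set" where
  "open_balls N = {{x. N (x - z) < \<rho>} | z \<rho>. \<rho> > 0}"

definition closed_balls :: "('a::real_vector \<Rightarrow> real) \<Rightarrow> 'a set set" where
  "closed_balls N = {{x. N (x - z) \<le> \<rho>} | z \<rho>. \<rho> > 0}"

end

theory Submission
  imports Defs
begin

text \<open>
  Four points of the plane have a Radon partition into two sets whose convex hulls meet. If one part
  is a single point, every convex set containing the other three contains it too. Otherwise the
  parts are pairs spanning segments that meet in a point \<open>x\<close>. If the segments are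
  parallel, an endpoint of one of them lies on the other; so let them be transversal. Suppose that a homothet \<open>K\<^sub>1\<close> picks
  out the first pair and \<open>K\<^sub>2\<close> the second, and let \<open>g\<close> be the homothety, with ratio \<open>\<mu>\<close>, carrying \<open>K\<^sub>2\<close>
  onto \<open>K\<^sub>1\<close>. Choosing \<open>p = x + a\<close> from the first pair and \<open>q = x + b\<close> from the second according
  to signs, one may write \<open>g x = x - c a + d b\<close> with \<open>c, d \<ge> 0\<close>. Then \<open>q\<close> lies in the triangle
  \<open>x, p, g q\<close> if \<open>1 + c \<le> d + \<mu>\<close>, and \<open>g p\<close> lies in the triangle \<open>g x, p, g q\<close> otherwise.
\<close>

section \<open>Convex combinations and directions in the plane\<close>

lemma convex_add_scaled:
  assumes "convex K" "z \<in> K" "z + e \<in> K" "z + f \<in> K" "u \<ge> 0" "v \<ge> 0" "u + v \<le> 1"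
  shows "z + u *\<^sub>R e + v *\<^sub>R f \<in> K"
proof -
  have "z + u *\<^sub>R e + v *\<^sub>R f = (1 - u - v) *\<^sub>R z + u *\<^sub>R (z + e) + v *\<^sub>R (z + f)"
    by (simp add: algebra_simps)
  moreover have "convex hull {z, z + e, z + f} \<subseteq> K"
    using assms by (simp add: hull_minimal)
  moreover have "(1 - u - v) *\<^sub>R z + u *\<^sub>R (z + e) + v *\<^sub>R (z + f) \<in> convex hull {z, z + e, z + f}"
    unfolding convex_hull_3 using assms
    by (intro CollectI exI[of _ "1 - u - v"] exI[of _ u] exI[of _ v]) auto
  ultimately show ?thesis by auto
qed

text \<open>Read \<open>g z = y + \<mu> *\<^sub>R (z - x)\<close>, \<open>p = x + a\<close>,
  \<open>q = x + b\<close>. From \<open>x\<close>, \<open>p\<close>, \<open>g x\<close>,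
  \<open>g q\<close> in \<open>K\<close> one obtains \<open>q\<close> or \<open>g p\<close> in
  \<open>K\<close>.\<close>

lemma homothetic_exchange:
  assumes "convex K" and "x \<in> K" "x + a \<in> K" "y \<in> K" "y + \<mu> *\<^sub>R b \<in> K"
    and y: "y = x - c *\<^sub>R a + d *\<^sub>R b"
    and "c \<ge> 0" "d \<ge> 0" "\<mu> > 0"
  shows "x + b \<in> K \<or> y + \<mu> *\<^sub>R a \<in> K"
proof (cases "1 + c \<le> d + \<mu>")
  case True
  \<comment> \<open>Since \<open>g q - x\<close> equals
    \<open>(d + \<mu>) *\<^sub>R b - c *\<^sub>R a\<close>, weight \<open>v\<close> on it gives
    \<open>b\<close> once weight \<open>c * v\<close> on \<open>a\<close> cancels the other term.
    The case assumption says that these weights sum to at most 1.\<close>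
  define v where "v = 1 / (d + \<mu>)"
  have v: "v * d + v * \<mu> = 1"
    using assms by (simp add: v_def flip: add_divide_distrib)
  have "x + (c * v) *\<^sub>R a + v *\<^sub>R (y + \<mu> *\<^sub>R b - x) \<in> K"
    using assms(1-5) assms(7-9) True
    by (intro convex_add_scaled) (auto simp: v_def add_divide_distrib[symmetric])
  also have "x + (c * v) *\<^sub>R a + v *\<^sub>R (y + \<mu> *\<^sub>R b - x) = x + (v * d + v * \<mu>) *\<^sub>R b"
    by (simp add: y algebra_simps)
  finally show ?thesis by (simp add: v)
next
  case False
  \<comment> \<open>Now the base point is \<open>g x = y\<close>. The weights
    \<open>\<mu> * w\<close> on \<open>p - y\<close> and \<open>d * w\<close> on
    \<open>g q - y\<close> cancel the \<open>b\<close> terms and leave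
    \<open>\<mu> *\<^sub>R a\<close>; their sum is below 1 by the negated case assumption.\<close>
  define w where "w = 1 / (1 + c)"
  have w: "w + w * c = 1"
    using assms by (simp add: w_def field_simps)
  have "y + (\<mu> * w) *\<^sub>R (x + a - y) + (d * w) *\<^sub>R (\<mu> *\<^sub>R b) \<in> K"
    using assms(1-5) assms(7-9) False
    by (intro convex_add_scaled) (auto simp: w_def add_divide_distrib[symmetric])
  also have "y + (\<mu> * w) *\<^sub>R (x + a - y) + (d * w) *\<^sub>R (\<mu> *\<^sub>R b) = y + (\<mu> * (w + w * c)) *\<^sub>R a"
    by (simp add: y algebra_simps)
  finally show ?thesis by (simp add: w)
qed

text \<open>The endpoints lie on opposite sides of \<open>x\<close>, so the sign of \<open>k\<close>
  decides which of them to take. This makes the coefficients nonnegative, as the exchange lemma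
  requires.\<close>

lemma closed_segment_direction:
  fixes x p q :: "'a::real_vector"
  assumes "x \<in> closed_segment p q" "x \<noteq> p" "x \<noteq> q"
  obtains e l where "e \<in> {p, q}" "l \<ge> 0" "k *\<^sub>R (p - x) = l *\<^sub>R (e - x)"
proof (cases "k \<ge> 0")
  case True
  then show ?thesis using that by blast
next
  case False
  from assms obtain u where u: "0 \<le> u" "u \<le> 1" "x = (1 - u) *\<^sub>R p + u *\<^sub>R q"
    by (auto simp: closed_segment_def)
  with assms have "u > 0" "u < 1" by (auto simp: less_le)
  have px: "p - x = u *\<^sub>R (p - q)" and qx: "q - x = (u - 1) *\<^sub>R (p - q)"
    by (simp_all add: u(3) algebra_simps)
  have "k *\<^sub>R (p - x) = (k * u / (u - 1)) *\<^sub>R (q - x)"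
    using \<open>u < 1\<close> by (simp add: px qx)
  moreover have "k * u / (u - 1) \<ge> 0"
    using False \<open>u > 0\<close> \<open>u < 1\<close> by (simp add: zero_le_divide_iff mult_le_0_iff)
  ultimately show ?thesis using that by blast
qed

lemma real2_dependent_or_spanning:
  fixes a b :: "real^2"
  assumes "a \<noteq> 0"
  obtains k where "b = k *\<^sub>R a" | "\<And>w. \<exists>c d. w = c *\<^sub>R a + d *\<^sub>R b"
proof (cases "a$1 * b$2 = a$2 * b$1")
  case True
  from assms consider "a$1 \<noteq> 0" | "a$2 \<noteq> 0"
    by (auto simp: vec_eq_iff forall_2)
  then show ?thesis
  proof cases
    case 1
    then have "b = (b$1 / a$1) *\<^sub>R a"
      using True by (simp add: vec_eq_iff forall_2 field_simps)
    then show ?thesis using that by blast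
  next
    case 2
    then have "b = (b$2 / a$2) *\<^sub>R a"
      using True by (simp add: vec_eq_iff forall_2 field_simps)
    then show ?thesis using that by blast
  qed
next
  case False
  \<comment> \<open>Cramer's rule.\<close>
  have "w = ((w$1 * b$2 - w$2 * b$1) / (a$1 * b$2 - a$2 * b$1)) *\<^sub>R a
          + ((a$1 * w$2 - a$2 * w$1) / (a$1 * b$2 - a$2 * b$1)) *\<^sub>R b" for w
    using False by (simp add: vec_eq_iff forall_2 divide_simps) (simp add: algebra_simps)
  then show ?thesis using that by blast
qed

section \<open>Homothets of a convex set\<close>

lemma convex_pos_homothets:
  assumes "convex C" "K \<in> pos_homothets C"
  shows "convex K"
proof -
  from assms(2) obtain s r where "K = (\<lambda>c. s *\<^sub>R c + r) ` C"
    by (auto simp: pos_homothets_def)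
  moreover have "(\<lambda>c. s *\<^sub>R c + r) ` C = (\<lambda>c. r + s *\<^sub>R c) ` C"
    by (simp add: add.commute)
  ultimately show ?thesis
    using convex_affinity[OF assms(1), of r s] by simp
qed

text \<open>Undo the map from \<open>C\<close> to \<open>K2\<close>, then apply the one to
  \<open>K1\<close>; the ratio is \<open>s / t\<close>. The equivalence also transports
  non-membership.\<close>

lemma pos_homothets_homothetic:
  assumes "K1 \<in> pos_homothets C" "K2 \<in> pos_homothets C"
  obtains \<mu> w where "\<mu> > 0" "\<forall>z. z \<in> K2 \<longleftrightarrow> \<mu> *\<^sub>R z + w \<in> K1"
proof -
  from assms obtain s r t u where
    K1: "s > 0" "K1 = (\<lambda>c. s *\<^sub>R c + r) ` C" and K2: "t > 0" "K2 = (\<lambda>c. t *\<^sub>R c + u) ` C"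
    by (auto simp: pos_homothets_def)
  have mem: "z \<in> (\<lambda>c. l *\<^sub>R c + v) ` C \<longleftrightarrow> (1 / l) *\<^sub>R (z - v) \<in> C" if "l > 0" for z v and l :: real
  proof
    assume "(1 / l) *\<^sub>R (z - v) \<in> C"
    then show "z \<in> (\<lambda>c. l *\<^sub>R c + v) ` C"
      using that by (intro image_eqI[where x = "(1 / l) *\<^sub>R (z - v)"]) auto
  qed (use that in auto)
  have "z \<in> K2 \<longleftrightarrow> (s / t) *\<^sub>R z + (r - (s / t) *\<^sub>R u) \<in> K1" for z
  proof -
    have "(1 / s) *\<^sub>R ((s / t) *\<^sub>R z + (r - (s / t) *\<^sub>R u) - r) = (1 / t) *\<^sub>R (z - u)"
      using K1(1) by (simp add: algebra_simps)
    then show ?thesis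
      by (simp add: K1(2) K2(2) mem[OF K1(1)] mem[OF K2(1)])
  qed
  then show ?thesis
    using that[of "s / t" "r - (s / t) *\<^sub>R u"] K1(1) K2(1) divide_pos_pos by blast
qed

lemma segments_of_homothets_disjoint:
  fixes C :: "(real^2) set"
  assumes "convex C" and K: "K1 \<in> pos_homothets C" "K2 \<in> pos_homothets C"
    and p: "p1 \<in> K1 - K2" "p2 \<in> K1 - K2" and q: "q1 \<in> K2 - K1" "q2 \<in> K2 - K1"
  shows "closed_segment p1 p2 \<inter> closed_segment q1 q2 = {}"
proof (rule ccontr)
  assume "\<not> ?thesis"
  then obtain x where xp: "x \<in> closed_segment p1 p2" and xq: "x \<in> closed_segment q1 q2"
    by blast
  have conv: "convex K1" "convex K2"
    using convex_pos_homothets assms by blast+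
  then have x: "x \<in> K1" "x \<in> K2"
    using p q xp xq by (meson DiffD1 closed_segment_subset subsetD)+
  then have ne: "x \<noteq> p1" "x \<noteq> p2" "x \<noteq> q1" "x \<noteq> q2"
    using p q by blast+
  obtain \<mu> w where \<mu>: "\<mu> > 0" and K2: "\<forall>z. z \<in> K2 \<longleftrightarrow> \<mu> *\<^sub>R z + w \<in> K1"
    by (rule pos_homothets_homothetic[OF K])
  define y where "y = \<mu> *\<^sub>R x + w"
  from ne have "p1 - x \<noteq> 0" by simp
  then consider k where "q1 - x = k *\<^sub>R (p1 - x)"
    | "\<And>w. \<exists>c d. w = c *\<^sub>R (p1 - x) + d *\<^sub>R (q1 - x)"
    using real2_dependent_or_spanning[of "p1 - x" "q1 - x"] by blast
  then show False
  proof cases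
    case 1
    obtain e l where e: "e \<in> {p1, p2}" "l \<ge> 0" "k *\<^sub>R (p1 - x) = l *\<^sub>R (e - x)"
      by (rule closed_segment_direction[OF xp ne(1,2)])
    have q1: "q1 - x = l *\<^sub>R (e - x)" using 1 e by simp
    show False
    \<comment> \<open>Parallel segments: \<open>e\<close> and \<open>q1\<close> lie on one ray from
      \<open>x\<close>, and the nearer one is between \<open>x\<close> and the other. So either
      \<open>q1\<close> falls into \<open>K1\<close> or \<open>e\<close> into
      \<open>K2\<close>.\<close>
    proof (cases "l \<le> 1")
      case True
      have "x + l *\<^sub>R (e - x) + 0 *\<^sub>R 0 \<in> K1"
        using conv x p e True by (intro convex_add_scaled) auto
      then show False using q q1[symmetric] by simp
    next
      case False
      have "x + (1 / l) *\<^sub>R (q1 - x) + 0 *\<^sub>R 0 \<in> K2"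
        using conv x q False by (intro convex_add_scaled) auto
      then show False using p e False q1 by auto
    qed
  next
    case 2
    obtain c d where cd: "y - x = c *\<^sub>R (p1 - x) + d *\<^sub>R (q1 - x)"
      using 2 by blast
    \<comment> \<open>The multiplier is \<open>- c\<close> because the exchange lemma subtracts its
      first term.\<close>
    obtain e l where e: "e \<in> {p1, p2}" "l \<ge> 0" "(- c) *\<^sub>R (p1 - x) = l *\<^sub>R (e - x)"
      by (rule closed_segment_direction[OF xp ne(1,2)])
    obtain f m where f: "f \<in> {q1, q2}" "m \<ge> 0" "d *\<^sub>R (q1 - x) = m *\<^sub>R (f - x)"
      by (rule closed_segment_direction[OF xq ne(3,4)])
    have ye: "y + \<mu> *\<^sub>R (e - x) = \<mu> *\<^sub>R e + w" and yf: "y + \<mu> *\<^sub>R (f - x) = \<mu> *\<^sub>R f + w"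
      by (simp_all add: y_def algebra_simps)
    have "x + (f - x) \<in> K1 \<or> y + \<mu> *\<^sub>R (e - x) \<in> K1"
    proof (rule homothetic_exchange[OF conv(1)])
      show "y \<in> K1" using x K2 by (simp add: y_def)
      show "y + \<mu> *\<^sub>R (f - x) \<in> K1" using yf K2 f q by auto
      have "c *\<^sub>R (p1 - x) = - l *\<^sub>R (e - x)"
        using e(3) by (metis scaleR_minus_left minus_equation_iff)
      then have "y - x = - l *\<^sub>R (e - x) + m *\<^sub>R (f - x)"
        using cd f(3) by metis
      then show "y = x - l *\<^sub>R (e - x) + m *\<^sub>R (f - x)"
        by (simp add: algebra_simps)
    qed (use x p e f \<mu> in auto)
    \<comment> \<open>The first alternative puts \<open>f\<close> into \<open>K1\<close>; the second
      puts the image of \<open>e\<close> into \<open>K1\<close>, hence \<open>e\<close> into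
      \<open>K2\<close>.\<close>
    then show False
      using ye K2 p q e f by auto
  qed
qed

lemma not_shatters_pos_homothets:
  fixes C S :: "(real^2) set"
  assumes C: "convex C" and S: "card S = 4"
  shows "\<not> shatters (pos_homothets C) S"
proof
  assume sh: "shatters (pos_homothets C) S"
  have fin: "finite S" using S card.infinite by fastforce
  have "affine_dependent S"
    using affine_dependent_biggerset[OF fin] S by simp
  then obtain A B0 where AB0: "A \<subseteq> S" "B0 \<subseteq> S" "A \<inter> B0 = {}" "convex hull A \<inter> convex hull B0 \<noteq> {}"
    by (rule Radon)
  \<comment> \<open>The Radon parts need not exhaust \<open>S\<close>; enlarging one to the
    complement keeps the hulls intersecting and makes the cardinalities add up to 4.\<close>
  define B where "B = S - A"
  have "convex hull B0 \<subseteq> convex hull B"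
    using AB0 by (intro hull_mono) (auto simp: B_def)
  with AB0 obtain x where x: "x \<in> convex hull A" "x \<in> convex hull B" by blast
  have B: "B \<subseteq> S" by (auto simp: B_def)
  obtain K1 where K1: "K1 \<in> pos_homothets C" "S \<inter> K1 = A"
    using sh AB0(1) by (auto simp: shatters_def)
  obtain K2 where K2: "K2 \<in> pos_homothets C" "S \<inter> K2 = B"
    using sh B by (auto simp: shatters_def)
  have "x \<in> K1" "x \<in> K2"
    using x K1 K2 convex_pos_homothets[OF C] hull_minimal[of _ _ convex] by (metis Int_lower2 subsetD)+
  then have "x \<notin> S"
    using K1 K2 by (auto simp: B_def)
  \<comment> \<open>The hull of a single point of \<open>S\<close> would put \<open>x\<close> into
    \<open>S\<close>. Applied to both parts, this leaves only the split into two pairs.\<close>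
  have ne: "card X \<noteq> 0" "card X \<noteq> 1" if "X \<subseteq> S" "x \<in> convex hull X" for X
    using that \<open>x \<notin> S\<close> finite_subset[OF that(1) fin] by (auto simp: card_1_singleton_iff)
  have "finite A" using AB0(1) fin by (rule finite_subset)
  then have "card A + card B = 4"
    using S AB0(1) fin card_mono[OF fin AB0(1)] by (simp add: B_def card_Diff_subset)
  then have "card A = 2" "card B = 2"
    using ne[OF AB0(1) x(1)] ne[OF B x(2)] by linarith+
  then obtain p1 p2 q1 q2 where pq: "A = {p1, p2}" "B = {q1, q2}"
    by (auto simp: card_2_iff)
  have "A \<subseteq> K1 - K2" "B \<subseteq> K2 - K1"
    using K1(2) K2(2) B_def by blast+
  then have "closed_segment p1 p2 \<inter> closed_segment q1 q2 = {}"
    by (intro segments_of_homothets_disjoint[OF C K1(1) K2(1)]) (auto simp: pq)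
  then show False
    using x by (auto simp: pq segment_convex_hull)
qed

section \<open>Shattering and VC dimension\<close>

lemma shatters_subset:
  assumes "shatters \<C> S" "T \<subseteq> S"
  shows "shatters \<C> T"
  unfolding shatters_def
proof (intro conjI allI impI)
  show "finite T" using assms finite_subset by (auto simp: shatters_def)
  fix A assume "A \<subseteq> T"
  with assms(2) have "A \<subseteq> S" by (rule order_trans[rotated])
  then obtain K where "K \<in> \<C>" "S \<inter> K = A"
    using assms(1) unfolding shatters_def by blast
  then show "\<exists>K\<in>\<C>. T \<inter> K = A"
    using \<open>A \<subseteq> T\<close> assms(2) by (intro bexI[of _ K]) auto
qed

text \<open>Shattering passes to subsets, so a larger shattered set would contain one of size
  exactly \<open>Suc n\<close>.\<close>

lemma vc_dim_le:
  assumes "\<And>S. card S = Suc n \<Longrightarrow> \<not> shatters \<C> S"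
  shows "vc_dim \<C> \<le> enat n"
  unfolding vc_dim_def
proof (rule SUP_least)
  fix S assume "S \<in> {S. shatters \<C> S}"
  then have sh: "shatters \<C> S" by simp
  have "card S \<le> n"
  proof (rule ccontr)
    assume "\<not> card S \<le> n"
    then obtain T where "T \<subseteq> S" "card T = Suc n"
      by (meson not_less_eq_eq obtain_subset_with_card_n)
    then show False using assms shatters_subset sh by blast
  qed
  then show "enat (card S) \<le> enat n" by simp
qed

lemma vc_dim_pos_homothets:
  fixes C :: "(real^2) set"
  assumes "convex C"
  shows "vc_dim (pos_homothets C) \<le> 3"
proof -
  have "vc_dim (pos_homothets C) \<le> enat 3"
    using not_shatters_pos_homothets[OF assms] by (intro vc_dim_le) auto
  then show ?thesis by (simp add: numeral_eq_enat)
qed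

section \<open>Balls of an arbitrary norm\<close>

lemma is_norm_scaled_diff:
  assumes "is_norm N" "\<rho> > 0"
  shows "N ((1 / \<rho>) *\<^sub>R (x - z)) = N (x - z) / \<rho>"
  using assms by (simp add: is_norm_def)

text \<open>The radius is the scaling factor and the centre the translation, so the result on convex
  sets applies to the unit ball.\<close>

lemma balls_eq_pos_homothets:
  assumes "is_norm N"
  shows open_balls_eq: "open_balls N = pos_homothets {x. N x < 1}"
    and closed_balls_eq: "closed_balls N = pos_homothets {x. N x \<le> 1}"
proof -
  have img: "(\<lambda>c. \<rho> *\<^sub>R c + z) ` U = {x. (1 / \<rho>) *\<^sub>R (x - z) \<in> U}" if "\<rho> > 0"
    for \<rho> :: real and z and U :: "'a set"
  proof (intro subset_antisym subsetI)
    fix x assume "x \<in> {x. (1 / \<rho>) *\<^sub>R (x - z) \<in> U}"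
    then show "x \<in> (\<lambda>c. \<rho> *\<^sub>R c + z) ` U"
      using that by (intro image_eqI[where x = "(1 / \<rho>) *\<^sub>R (x - z)"]) auto
  qed (use that in auto)
  have "{x. N (x - z) < \<rho>} = (\<lambda>c. \<rho> *\<^sub>R c + z) ` {x. N x < 1}"
    and "{x. N (x - z) \<le> \<rho>} = (\<lambda>c. \<rho> *\<^sub>R c + z) ` {x. N x \<le> 1}" if "\<rho> > 0" for z \<rho>
    unfolding img[OF that] mem_Collect_eq is_norm_scaled_diff[OF assms that]
    using that by simp_all
  then show "open_balls N = pos_homothets {x. N x < 1}"
    and "closed_balls N = pos_homothets {x. N x \<le> 1}"
    unfolding open_balls_def closed_balls_def pos_homothets_def by blast+
qed

lemma convex_unit_balls:
  assumes "is_norm N"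
  shows "convex {x. N x < 1}" "convex {x. N x \<le> 1}"
proof -
  have bd: "N (u *\<^sub>R x + v *\<^sub>R y) \<le> u * N x + v * N y" if "u \<ge> 0" "v \<ge> 0" for u v x y
    using assms that unfolding is_norm_def by (metis abs_of_nonneg)
  show "convex {x. N x < 1}"
    by (rule convexI) (auto intro: le_less_trans[OF bd] convex_bound_lt)
  show "convex {x. N x \<le> 1}"
    by (rule convexI) (auto intro: order_trans[OF bd] convex_bound_le)
qed

theorem theorem7:
  shows "(\<forall>C :: (real^2) set. convex C \<longrightarrow>
            (\<forall>S :: (real^2) set. card S = 4 \<longrightarrow> \<not> shatters (pos_homothets C) S) \<and>
            vc_dim (pos_homothets C) \<le> 3) \<and>
         (\<forall>N :: real^2 \<Rightarrow> real. is_norm N \<longrightarrow>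
            vc_dim (open_balls N) \<le> 3 \<and> vc_dim (closed_balls N) \<le> 3)"
  by (simp add: not_shatters_pos_homothets vc_dim_pos_homothets convex_unit_balls
      open_balls_eq closed_balls_eq)

end
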